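(* Every core compact well-filtered space is sober.
   Context: A space $X$ is core compact if its lattice $\mathcal O(X)$ of open sets, ordered by inclusion, is a continuous lattice. For a $T_0$ space $X$, the specialization order is $x\le y$ iff $x\in\overline{\{y\}}$, and $\mathsf{K}(X)$ is the set of nonempty compact saturated subsets (saturated = upper set in the specialization order). A family $\mathcal K\subseteq \mathsf K(X)$ is filtered if it is nonempty and for all $K_1,K_2\in\mathcal K$ there is $K_3\in\mathcal K$ with $K_3\subseteq K_1\cap K_2$. $X$ is well-filtered if it is $T_0$ and for every open $U\subseteq X$ and every filtered family $\mathcal K\subseteq\mathsf K(X)$, $\bigcap\mathcal K\subseteq U$ implies $K\subseteq U$ for some $K\in\mathcal K$. $X$ is sober if every irreducible closed subset of $X$ is $\overline{\{a\}}$ for a unique $a\in X$. *)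

theory Defs
  imports "HOL-Analysis.Abstract_Topological_Spaces" "HOL-Algebra.Complete_Lattice"
begin

definition directed_in :: "('a, 'b) gorder_scheme \<Rightarrow> 'a set \<Rightarrow> bool" where
  "directed_in L D \<longleftrightarrow> D \<subseteq> carrier L \<and> D \<noteq> {} \<and>
     (\<forall>x\<in>D. \<forall>y\<in>D. \<exists>z\<in>D. x \<sqsubseteq>\<^bsub>L\<^esub> z \<and> y \<sqsubseteq>\<^bsub>L\<^esub> z)"

text \<open>The way-below relation is only used for complete lattices, where all suprema exist.\<close>

definition way_below :: "('a, 'b) gorder_scheme \<Rightarrow> 'a \<Rightarrow> 'a \<Rightarrow> bool" where
  "way_below L x y \<longleftrightarrow> x \<in> carrier L \<and> y \<in> carrier L \<and>
     (\<forall>D. directed_in L D \<longrightarrow> y \<sqsubseteq>\<^bsub>L\<^esub> \<Squnion>\<^bsub>L\<^esub>D \<longrightarrow> (\<exists>d\<in>D. x \<sqsubseteq>\<^bsub>L\<^esub> d))"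

text \<open>In a complete lattice the elements way below a given one are automatically directed,
  so this agrees with the definition of a continuous poset.\<close>

definition continuous_lattice :: "('a, 'b) gorder_scheme \<Rightarrow> bool" where
  "continuous_lattice L \<longleftrightarrow> complete_lattice L \<and>
     (\<forall>x\<in>carrier L. x = \<Squnion>\<^bsub>L\<^esub>{y. way_below L y x})"

definition open_lattice :: "'a topology \<Rightarrow> 'a set gorder" where
  "open_lattice X = \<lparr>carrier = {U. openin X U}, eq = (=), le = (\<subseteq>)\<rparr>"

definition core_compact_space :: "'a topology \<Rightarrow> bool" where
  "core_compact_space X \<longleftrightarrow> continuous_lattice (open_lattice X)"

definition spec_le :: "'a topology \<Rightarrow> 'a \<Rightarrow> 'a \<Rightarrow> bool" where
  "spec_le X x y \<longleftrightarrow> x \<in> topspace X \<and> y \<in> topspace X \<and> x \<in> X closure_of {y}"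

definition saturatedin :: "'a topology \<Rightarrow> 'a set \<Rightarrow> bool" where
  "saturatedin X S \<longleftrightarrow> S \<subseteq> topspace X \<and> (\<forall>x\<in>S. \<forall>y. spec_le X x y \<longrightarrow> y \<in> S)"

definition compact_saturated_sets :: "'a topology \<Rightarrow> 'a set set" where
  "compact_saturated_sets X = {K. K \<noteq> {} \<and> compactin X K \<and> saturatedin X K}"

definition filtered_family :: "'a set set \<Rightarrow> bool" where
  "filtered_family \<K> \<longleftrightarrow> \<K> \<noteq> {} \<and> (\<forall>K1\<in>\<K>. \<forall>K2\<in>\<K>. \<exists>K3\<in>\<K>. K3 \<subseteq> K1 \<inter> K2)"

definition well_filtered_space :: "'a topology \<Rightarrow> bool" where
  "well_filtered_space X \<longleftrightarrow> t0_space X \<and>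
     (\<forall>U \<K>. openin X U \<longrightarrow> \<K> \<subseteq> compact_saturated_sets X \<longrightarrow> filtered_family \<K> \<longrightarrow>
        \<Inter>\<K> \<subseteq> U \<longrightarrow> (\<exists>K\<in>\<K>. K \<subseteq> U))"

text \<open>Irreducible sets are nonempty by convention.\<close>

definition irreduciblein :: "'a topology \<Rightarrow> 'a set \<Rightarrow> bool" where
  "irreduciblein X S \<longleftrightarrow> S \<subseteq> topspace X \<and> S \<noteq> {} \<and>
     (\<forall>A B. closedin X A \<longrightarrow> closedin X B \<longrightarrow> S \<subseteq> A \<union> B \<longrightarrow> S \<subseteq> A \<or> S \<subseteq> B)"

definition sober_space :: "'a topology \<Rightarrow> bool" where
  "sober_space X \<longleftrightarrow>
     (\<forall>C. closedin X C \<longrightarrow> irreduciblein X C \<longrightarrow> (\<exists>!a. a \<in> topspace X \<and> C = X closure_of {a}))"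

end

theory Submission
  imports Defs
begin

text \<open>
  The crux is that a core compact well-filtered space is locally compact. If $V \ll U$, then
  interpolation yields a sequence $U = U_0 \gg U_1 \gg \cdots$ of open sets containing $V$, and the
  claim is that $\bigcap_n U_n$ is compact. For this it suffices that an open $W$ containing
  $\bigcap_n U_n$ contains some $U_n$. Otherwise Zorn's lemma gives a maximal open $O \supseteq W$
  containing no $U_n$; pick $x_n \in U_n \setminus O$. By maximality every open set not contained
  in $O$ contains almost all $x_n$, so the tails of $(x_n)$ are compact, and well-filteredness
  applied to their saturations, whose intersection lies in $\bigcap_n U_n \subseteq W$, puts some
  $x_n$ into $W$, a contradiction. Given local compactness, for an irreducible closed set $C$ the
  compact saturated sets whose interior meets $C$ form a filtered family, and well-filteredness
  gives a point of $C$ in its intersection; this point is generic.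
\<close>

section \<open>The specialization order and compact saturated sets\<close>

lemma spec_le_iff:
  "spec_le X x y \<longleftrightarrow>
     x \<in> topspace X \<and> y \<in> topspace X \<and> (\<forall>U. openin X U \<longrightarrow> x \<in> U \<longrightarrow> y \<in> U)"
  by (auto simp: spec_le_def in_closure_of)

lemma saturatedin_openin: "openin X U \<Longrightarrow> saturatedin X U"
  by (auto simp: saturatedin_def spec_le_iff dest: openin_subset)

lemma saturatedin_Inter: "\<S> \<noteq> {} \<Longrightarrow> (\<And>S. S \<in> \<S> \<Longrightarrow> saturatedin X S) \<Longrightarrow> saturatedin X (\<Inter>\<S>)"
  unfolding saturatedin_def by blast

text \<open>Open sets are upper sets in the specialization order, so open sets that cover
  \<open>S\<close> also cover its saturation, and compactness passes from one to the other.\<close>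

lemma saturation_compact_saturated:
  assumes "compactin X S" "S \<noteq> {}"
  shows "{y. \<exists>s\<in>S. spec_le X s y} \<in> compact_saturated_sets X"
proof -
  let ?K = "{y. \<exists>s\<in>S. spec_le X s y}"
  have S: "S \<subseteq> topspace X"
    using assms(1) by (rule compactin_subset_topspace)
  have S_le: "S \<subseteq> ?K"
    using S by (auto simp: spec_le_iff)
  have "compactin X ?K"
    unfolding compactin_def
  proof (intro conjI allI impI)
    show "?K \<subseteq> topspace X"
      by (auto simp: spec_le_iff)
    fix \<U> assume \<U>: "Ball \<U> (openin X) \<and> ?K \<subseteq> \<Union>\<U>"
    then obtain \<F> where \<F>: "finite \<F>" "\<F> \<subseteq> \<U>" "S \<subseteq> \<Union>\<F>"
      using assms(1) S_le unfolding compactin_def by (meson subset_trans)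
    have "openin X (\<Union>\<F>)"
      using \<F> \<U> by blast
    then have "?K \<subseteq> \<Union>\<F>"
      using \<F>(3) unfolding spec_le_iff by blast
    then show "\<exists>\<F>. finite \<F> \<and> \<F> \<subseteq> \<U> \<and> ?K \<subseteq> \<Union>\<F>"
      using \<F> by blast
  qed
  moreover have "saturatedin X ?K"
    unfolding saturatedin_def spec_le_iff by blast
  ultimately show ?thesis
    using S_le assms(2) unfolding compact_saturated_sets_def by blast
qed

lemma well_filtered_spaceE:
  assumes "well_filtered_space X" "openin X U" "\<K> \<subseteq> compact_saturated_sets X"
    "filtered_family \<K>" "\<Inter>\<K> \<subseteq> U"
  obtains K where "K \<in> \<K>" "K \<subseteq> U"
  using assms unfolding well_filtered_space_def by blast

section \<open>The way-below relation on open sets\<close>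

lemma sup_open_lattice:
  assumes "\<And>U. U \<in> \<U> \<Longrightarrow> openin X U"
  shows "\<Squnion>\<^bsub>open_lattice X\<^esub>\<U> = \<Union>\<U>"
proof -
  have "least (open_lattice X) (\<Union>\<U>) (Upper (open_lattice X) \<U>)"
    using assms by (auto simp: least_def Upper_def open_lattice_def)
  \<comment> \<open>\<open>sup\<close> is a Hilbert choice among least upper bounds, so uniqueness
    is what identifies it with the union.\<close>
  moreover have "s = \<Union>\<U>" if "least (open_lattice X) s (Upper (open_lattice X) \<U>)" for s
    using that calculation by (simp add: least_def open_lattice_def subset_antisym)
  ultimately show ?thesis
    unfolding sup_def by (metis (mono_tags, lifting) someI_ex)
qed

lemma directed_in_open_lattice:
  "directed_in (open_lattice X) D \<longleftrightarrow>
     (\<forall>U\<in>D. openin X U) \<and> D \<noteq> {} \<and> (\<forall>U\<in>D. \<forall>V\<in>D. \<exists>W\<in>D. U \<union> V \<subseteq> W)"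
  by (auto simp: directed_in_def open_lattice_def)

lemma way_below_open_lattice:
  "way_below (open_lattice X) V U \<longleftrightarrow> openin X V \<and> openin X U \<and>
     (\<forall>D. directed_in (open_lattice X) D \<longrightarrow> U \<subseteq> \<Union>D \<longrightarrow> (\<exists>W\<in>D. V \<subseteq> W))"
proof -
  have "\<Squnion>\<^bsub>open_lattice X\<^esub>D = \<Union>D" if "directed_in (open_lattice X) D" for D
    using that by (simp add: directed_in_open_lattice sup_open_lattice)
  then show ?thesis
    unfolding way_below_def by (auto simp: open_lattice_def)
qed

lemma way_below_openD:
  assumes "way_below (open_lattice X) V U"
  shows "openin X V" "openin X U"
  using assms by (auto simp: way_below_open_lattice)

lemma way_below_openE:
  assumes "way_below (open_lattice X) V U" "U \<subseteq> \<Union>D" "D \<noteq> {}"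
    and "\<And>W. W \<in> D \<Longrightarrow> openin X W"
    and "\<And>W W'. W \<in> D \<Longrightarrow> W' \<in> D \<Longrightarrow> \<exists>W''\<in>D. W \<union> W' \<subseteq> W''"
  obtains W where "W \<in> D" "V \<subseteq> W"
proof -
  have "directed_in (open_lattice X) D"
    using assms(3-5) by (simp add: directed_in_open_lattice)
  then show ?thesis
    using assms(1,2) that unfolding way_below_open_lattice by blast
qed

lemma way_below_open_subset:
  assumes "way_below (open_lattice X) V U"
  shows "V \<subseteq> U"
  by (rule way_below_openE[OF assms, of "{U}"]) (use way_below_openD[OF assms] in auto)

lemma way_below_open_mono:
  assumes "way_below (open_lattice X) V U" "openin X V'" "V' \<subseteq> V" "openin X U'" "U \<subseteq> U'"
  shows "way_below (open_lattice X) V' U'"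
  using assms unfolding way_below_open_lattice by (meson subset_trans)

lemma way_below_open_Un:
  assumes "way_below (open_lattice X) V U" "way_below (open_lattice X) V' U"
  shows "way_below (open_lattice X) (V \<union> V') U"
  unfolding way_below_open_lattice
proof (intro conjI allI impI)
  fix D assume D: "directed_in (open_lattice X) D" "U \<subseteq> \<Union>D"
  then obtain W W' where "W \<in> D" "V \<subseteq> W" "W' \<in> D" "V' \<subseteq> W'"
    using assms unfolding way_below_open_lattice by meson
  moreover from this obtain W'' where "W'' \<in> D" "W \<union> W' \<subseteq> W''"
    using D(1) unfolding directed_in_open_lattice by meson
  ultimately show "\<exists>W\<in>D. V \<union> V' \<subseteq> W"
    by blast
qed (use assms in \<open>auto dest: way_below_openD\<close>)

lemma way_below_empty:
  assumes "openin X U"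
  shows "way_below (open_lattice X) {} U"
  using assms by (auto simp: way_below_open_lattice directed_in_open_lattice)

section \<open>Core compactness and interpolation\<close>

lemma core_compact_nbhd:
  assumes "core_compact_space X" "openin X U" "x \<in> U"
  obtains V where "way_below (open_lattice X) V U" "x \<in> V"
proof -
  have "U = \<Squnion>\<^bsub>open_lattice X\<^esub>{V. way_below (open_lattice X) V U}"
    using assms(1,2) unfolding core_compact_space_def continuous_lattice_def
    by (simp add: open_lattice_def)
  also have "\<dots> = \<Union>{V. way_below (open_lattice X) V U}"
    by (rule sup_open_lattice) (auto dest: way_below_openD)
  finally show ?thesis
    using assms(3) that by auto
qed

text \<open>The open sets lying two way-below steps under \<open>U\<close> form a directed family,
  which covers \<open>U\<close> by applying \<open>core_compact_nbhd\<close> twice at each point.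
  Hence \<open>V\<close> lies in one of its members, and the middle set of the two steps
  interpolates.\<close>

lemma core_compact_interpolation:
  assumes "core_compact_space X" "way_below (open_lattice X) V U"
  obtains W where "way_below (open_lattice X) V W" "way_below (open_lattice X) W U"
proof -
  let ?D = "{W. \<exists>W'. way_below (open_lattice X) W W' \<and> way_below (open_lattice X) W' U}"
  have U: "openin X U"
    using assms(2) by (rule way_below_openD)
  have cover: "U \<subseteq> \<Union>?D"
  proof
    fix x assume "x \<in> U"
    then obtain W' where W': "way_below (open_lattice X) W' U" "x \<in> W'"
      using assms(1) U core_compact_nbhd by metis
    then obtain W where "way_below (open_lattice X) W W'" "x \<in> W"
      using assms(1) core_compact_nbhd way_below_openD by metis
    with W' show "x \<in> \<Union>?D"
      by blast
  qed
  have ne: "?D \<noteq> {}"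
    using way_below_empty[OF U] way_below_empty[of X "{}"] by auto
  have directed: "\<exists>W\<in>?D. A \<union> B \<subseteq> W" if AB: "A \<in> ?D" "B \<in> ?D" for A B
  proof -
    obtain A' B' where
      A: "way_below (open_lattice X) A A'" "way_below (open_lattice X) A' U" and
      B: "way_below (open_lattice X) B B'" "way_below (open_lattice X) B' U"
      using AB by blast
    have "openin X (A' \<union> B')"
      using A B by (auto dest: way_below_openD)
    then have "way_below (open_lattice X) (A \<union> B) (A' \<union> B')"
      using A(1) B(1) by (intro way_below_open_Un; elim way_below_open_mono)
        (auto dest: way_below_openD)
    moreover have "way_below (open_lattice X) (A' \<union> B') U"
      using A(2) B(2) by (rule way_below_open_Un)
    ultimately show ?thesis
      by blast
  qed
  obtain W where "W \<in> ?D" "V \<subseteq> W"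
    by (rule way_below_openE[OF assms(2) cover ne]) (use directed in \<open>auto dest: way_below_openD\<close>)
  then obtain W' where "way_below (open_lattice X) W W'" "way_below (open_lattice X) W' U"
    by blast
  moreover from this have "way_below (open_lattice X) V W'"
    using \<open>V \<subseteq> W\<close> assms(2) by (elim way_below_open_mono) (auto dest: way_below_openD)
  ultimately show ?thesis
    using that by blast
qed

lemma core_compact_way_below_sequence:
  assumes "core_compact_space X" "way_below (open_lattice X) V U"
  obtains S :: "nat \<Rightarrow> 'a set" where "S 0 = U" "\<And>n. V \<subseteq> S n"
    "\<And>n. way_below (open_lattice X) (S (Suc n)) (S n)"
proof -
  \<comment> \<open>The invariant is that \<open>V\<close> is way below \<open>S n\<close>, not
    merely contained in it, since interpolation needs this to produce the next term. The clause for
    \<open>n = 0\<close> fixes the start.\<close>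
  have "\<exists>S. \<forall>n::nat. (way_below (open_lattice X) V (S n) \<and> (n = 0 \<longrightarrow> S n = U)) \<and>
      way_below (open_lattice X) (S (Suc n)) (S n)"
  proof (rule dependent_nat_choice)
    fix W and n :: nat
    assume "way_below (open_lattice X) V W \<and> (n = 0 \<longrightarrow> W = U)"
    then show "\<exists>W'. (way_below (open_lattice X) V W' \<and> (Suc n = 0 \<longrightarrow> W' = U)) \<and>
        way_below (open_lattice X) W' W"
      using core_compact_interpolation[OF assms(1)] by (metis nat.simps(3))
  qed (use assms(2) in blast)
  then show ?thesis
    using that way_below_open_subset by metis
qed

section \<open>Compactness from well-filteredness\<close>

lemma maximal_open_avoiding:
  assumes S: "\<And>n. way_below (open_lattice X) (S (Suc n)) (S n)"
    and W: "openin X W" "\<And>n. \<not> S n \<subseteq> W"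
  obtains M where "openin X M" "W \<subseteq> M" "\<And>n. \<not> S n \<subseteq> M"
    "\<And>G. openin X G \<Longrightarrow> \<not> G \<subseteq> M \<Longrightarrow> \<exists>n. S n \<subseteq> M \<union> G"
proof -
  let ?A = "{M. openin X M \<and> W \<subseteq> M \<and> (\<forall>n. \<not> S n \<subseteq> M)}"
  have "\<exists>M\<in>?A. \<forall>N\<in>?A. M \<subseteq> N \<longrightarrow> N = M"
  proof (rule subset_Zorn_nonempty)
    show "?A \<noteq> {}"
      using W by blast
  next
    fix \<C> assume \<C>: "\<C> \<noteq> {}" "subset.chain ?A \<C>"
    have "\<not> S n \<subseteq> \<Union>\<C>" for n
    proof
      assume "S n \<subseteq> \<Union>\<C>"
      \<comment> \<open>A chain is directed, so \<open>S (Suc n)\<close> being way below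
        \<open>S n\<close> places it inside a single member of the chain, which membership in
        \<open>?A\<close> forbids.\<close>
      from S[of n] this \<open>\<C> \<noteq> {}\<close> obtain M where "M \<in> \<C>" "S (Suc n) \<subseteq> M"
      proof (rule way_below_openE)
        show "openin X M" if "M \<in> \<C>" for M
          using \<C>(2) that unfolding subset.chain_def by blast
        show "\<exists>N\<in>\<C>. M \<union> M' \<subseteq> N" if "M \<in> \<C>" "M' \<in> \<C>" for M M'
          using \<C>(2) that unfolding subset_chain_def by (metis Un_absorb1 Un_absorb2 order_refl)
      qed
      then show False
        using \<C>(2) unfolding subset.chain_def by blast
    qed
    moreover have "openin X (\<Union>\<C>)" "W \<subseteq> \<Union>\<C>"
      using \<C> unfolding subset.chain_def by blast+
    ultimately show "\<Union>\<C> \<in> ?A"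
      by blast
  qed
  then obtain M where M: "M \<in> ?A" "\<forall>N\<in>?A. M \<subseteq> N \<longrightarrow> N = M"
    by (rule bexE)
  have "\<exists>n. S n \<subseteq> M \<union> G" if "openin X G" "\<not> G \<subseteq> M" for G
  proof (rule ccontr)
    assume "\<not> ?thesis"
    \<comment> \<open>Otherwise \<open>M \<union> G\<close> is a member of \<open>?A\<close> above
      \<open>M\<close>, and maximality forces \<open>G \<subseteq> M\<close>.\<close>
    with M(1) that have "M \<union> G \<in> ?A"
      by (auto intro: openin_Un)
    from M(2)[rule_format, OF this] that show False
      by blast
  qed
  with M(1) show ?thesis
    using that by blast
qed

lemma well_filtered_way_below_sequence:
  assumes X: "well_filtered_space X"
    and S: "\<And>n. way_below (open_lattice X) (S (Suc n)) (S n)"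
    and W: "openin X W" "(\<Inter>n. S n) \<subseteq> W"
  shows "\<exists>n. S n \<subseteq> W"
proof (rule ccontr)
  assume "\<not> ?thesis"
  then obtain M where M: "openin X M" "W \<subseteq> M" "\<And>n. \<not> S n \<subseteq> M"
    "\<And>G. openin X G \<Longrightarrow> \<not> G \<subseteq> M \<Longrightarrow> \<exists>n. S n \<subseteq> M \<union> G"
    using maximal_open_avoiding[of X S, OF S W(1)] by metis
  have S_open: "openin X (S n)" for n
    using S by (rule way_below_openD)
  have S_anti: "S k \<subseteq> S n" if "n \<le> k" for n k
    using way_below_open_subset[OF S] that by (rule lift_Suc_antimono_le)
  have "\<forall>n. \<exists>x. x \<in> S n - M"
    using M(3) by blast
  then obtain x where x: "\<And>n. x n \<in> S n" "\<And>n. x n \<notin> M"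
    by (metis DiffE)
  have x_top: "x n \<in> topspace X" for n
    using x(1) S_open openin_subset by blast
  \<comment> \<open>As \<open>x m\<close> is outside \<open>M\<close>, so \<open>G\<close> is not
    contained in \<open>M\<close>, and maximality yields
    \<open>S n \<subseteq> M \<union> G\<close>. The sets \<open>S k\<close> decrease and every
    \<open>x k\<close> avoids \<open>M\<close>, so \<open>x k\<close> is in \<open>G\<close> from
    \<open>n\<close> on.\<close>
  have cofinite: "\<exists>n. \<forall>k\<ge>n. x k \<in> G" if G: "openin X G" "x m \<in> G" for G m
  proof -
    obtain n where "S n \<subseteq> M \<union> G"
      using M(4) G x(2) by blast
    then show ?thesis
      using x S_anti by blast
  qed
  have tail_compact: "compactin X (x ` {n..})" for n
    unfolding compactin_def
  proof (intro conjI allI impI)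
    fix \<U> assume \<U>: "Ball \<U> (openin X) \<and> x ` {n..} \<subseteq> \<Union>\<U>"
    then obtain A where A: "A \<in> \<U>" "x n \<in> A"
      by force
    \<comment> \<open>The single cover member \<open>A\<close> absorbs all but finitely many points
      of the tail.\<close>
    obtain m where m: "\<forall>k\<ge>m. x k \<in> A"
      using cofinite[of A n] A \<U> by blast
    have "x ` {n..<m} \<subseteq> \<Union>\<U>"
      using \<U> by auto
    then obtain \<F> where \<F>: "finite \<F>" "\<F> \<subseteq> \<U>" "x ` {n..<m} \<subseteq> \<Union>\<F>"
      by (meson finite_subset_Union finite_imageI finite_atLeastLessThan)
    have "x ` {n..} \<subseteq> \<Union>(insert A \<F>)"
    proof
      fix y assume "y \<in> x ` {n..}"
      then obtain k where "y = x k" "n \<le> k"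
        by blast
      then show "y \<in> \<Union>(insert A \<F>)"
        using m \<F>(3) by (cases "m \<le> k") (auto simp: image_subset_iff)
    qed
    then show "\<exists>\<F>. finite \<F> \<and> \<F> \<subseteq> \<U> \<and> x ` {n..} \<subseteq> \<Union>\<F>"
      using A(1) \<F>(1,2) by (intro exI[of _ "insert A \<F>"]) simp
  qed (use x_top in auto)
  define K where "K n = {y. \<exists>s\<in>x ` {n..}. spec_le X s y}" for n
  have "range K \<subseteq> compact_saturated_sets X"
    using saturation_compact_saturated[OF tail_compact] by (auto simp: K_def)
  moreover have "filtered_family (range K)"
  proof -
    have "K (max m n) \<subseteq> K m \<inter> K n" for m n
      by (force simp: K_def)
    then show ?thesis
      unfolding filtered_family_def by blast
  qed
  moreover have "\<Inter>(range K) \<subseteq> W"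
  proof -
    \<comment> \<open>\<open>S n\<close> is open, hence an upper set, and contains the tail from
      \<open>n\<close> on; so it contains the saturation of that tail.\<close>
    have "K n \<subseteq> S n" for n
    proof
      fix y assume "y \<in> K n"
      then obtain k where "n \<le> k" "spec_le X (x k) y"
        by (auto simp: K_def)
      then show "y \<in> S n"
        using x(1)[of k] S_open[of n] S_anti[of n k] unfolding spec_le_iff by blast
    qed
    then have "\<Inter>(range K) \<subseteq> \<Inter>(range S)"
      by (intro INF_mono) auto
    then show ?thesis
      using W(2) by (rule subset_trans)
  qed
  ultimately obtain n where "K n \<subseteq> W"
    using well_filtered_spaceE[OF X W(1), of "range K"] by blast
  moreover have "x n \<in> K n"
    using x_top by (auto simp: K_def spec_le_iff)
  ultimately show False
    using M(2) x(2) by blast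
qed

text \<open>This is local compactness in the form needed for sobriety. The witness \<open>K\<close>
  is the intersection of a descending way-below sequence that starts at \<open>U\<close> and stays
  above \<open>V\<close>.\<close>

lemma compact_saturated_between_way_below:
  assumes "core_compact_space X" "well_filtered_space X" "way_below (open_lattice X) V U"
  obtains K where "compactin X K" "saturatedin X K" "V \<subseteq> K" "K \<subseteq> U"
proof -
  obtain S :: "nat \<Rightarrow> 'a set" where S: "S 0 = U" "\<And>n. V \<subseteq> S n"
    "\<And>n. way_below (open_lattice X) (S (Suc n)) (S n)"
    using core_compact_way_below_sequence[OF assms(1,3)] by metis
  have S_open: "openin X (S n)" for n
    using S(3) by (rule way_below_openD)
  have "compactin X (\<Inter>n. S n)"
    unfolding compactin_def
  proof (intro conjI allI impI)
    show "(\<Inter>n. S n) \<subseteq> topspace X"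
      using S_open openin_subset by blast
    fix \<U> assume \<U>: "Ball \<U> (openin X) \<and> (\<Inter>n. S n) \<subseteq> \<Union>\<U>"
    then obtain n where n: "S n \<subseteq> \<Union>\<U>"
      using well_filtered_way_below_sequence[of X S "\<Union>\<U>", OF assms(2) S(3)] by blast
    \<comment> \<open>Finite unions of cover members form a directed family. One of them contains
      \<open>S (Suc n)\<close>, which is way below \<open>S n\<close>, and therefore the whole
      intersection.\<close>
    let ?D = "{\<Union>\<F> |\<F>. finite \<F> \<and> \<F> \<subseteq> \<U>}"
    have "\<Union>\<U> \<subseteq> \<Union>?D"
    proof
      fix y assume "y \<in> \<Union>\<U>"
      then obtain A where "A \<in> \<U>" "y \<in> A"
        by blast
      moreover from this have "\<Union>{A} \<in> ?D"
        by blast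
      ultimately show "y \<in> \<Union>?D"
        by auto
    qed
    with n have "S n \<subseteq> \<Union>?D"
      by (rule subset_trans)
    from S(3)[of n] this obtain A where "A \<in> ?D" "S (Suc n) \<subseteq> A"
    proof (rule way_below_openE)
      show "\<exists>W''\<in>?D. W \<union> W' \<subseteq> W''" if "W \<in> ?D" "W' \<in> ?D" for W W'
      proof -
        obtain \<F> \<F>' where "finite \<F>" "\<F> \<subseteq> \<U>" "W = \<Union>\<F>" "finite \<F>'" "\<F>' \<subseteq> \<U>" "W' = \<Union>\<F>'"
          using \<open>W \<in> ?D\<close> \<open>W' \<in> ?D\<close> by blast
        then have "\<Union>(\<F> \<union> \<F>') \<in> ?D" "W \<union> W' \<subseteq> \<Union>(\<F> \<union> \<F>')"
          by (blast intro: finite_UnI)+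
        then show ?thesis
          by (rule bexI[rotated])
      qed
      show "?D \<noteq> {}"
        by blast
      show "openin X W" if "W \<in> ?D" for W
        using that \<U> by blast
    qed
    then show "\<exists>\<F>. finite \<F> \<and> \<F> \<subseteq> \<U> \<and> (\<Inter>n. S n) \<subseteq> \<Union>\<F>"
      by blast
  qed
  moreover have "saturatedin X (\<Inter>n. S n)"
    using S_open by (intro saturatedin_Inter) (auto intro: saturatedin_openin)
  ultimately show ?thesis
    using that S(1,2) by blast
qed

section \<open>Irreducible closed sets and generic points\<close>

lemma irreduciblein_meets_Int:
  assumes "irreduciblein X C" "openin X U" "openin X V" "C \<inter> U \<noteq> {}" "C \<inter> V \<noteq> {}"
  shows "C \<inter> (U \<inter> V) \<noteq> {}"
proof
  assume "C \<inter> (U \<inter> V) = {}"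
  \<comment> \<open>Complements turn disjointness into a cover of \<open>C\<close> by two closed
    sets, to which irreducibility applies.\<close>
  then have "C \<subseteq> (topspace X - U) \<union> (topspace X - V)"
    using assms(1) unfolding irreduciblein_def by blast
  moreover have "closedin X (topspace X - U)" "closedin X (topspace X - V)"
    using assms(2,3) by auto
  ultimately have "C \<subseteq> topspace X - U \<or> C \<subseteq> topspace X - V"
    using assms(1) unfolding irreduciblein_def by blast
  then show False
    using assms(4,5) by blast
qed

text \<open>Equal closures put each point below the other in the specialization order, so no open
  set separates them. This yields uniqueness of the generic point.\<close>

lemma t0_space_closure_of_singleton_inject:
  assumes "t0_space X" "x \<in> topspace X" "y \<in> topspace X" "X closure_of {x} = X closure_of {y}"
  shows "x = y"
proof -
  have "spec_le X x y" "spec_le X y x"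
    using assms(2-4) closure_of_subset[of "{x}" X] closure_of_subset[of "{y}" X]
    by (auto simp: spec_le_def)
  then show ?thesis
    using assms(1) unfolding spec_le_iff t0_space_def by metis
qed

theorem theorem6p16:
  fixes X :: "'a topology"
  assumes "core_compact_space X"
    and "well_filtered_space X"
  shows "sober_space X"
  unfolding sober_space_def
proof (intro allI impI)
  fix C assume C: "closedin X C" "irreduciblein X C"
  have C_top: "C \<subseteq> topspace X" "C \<noteq> {}"
    using C(2) by (auto simp: irreduciblein_def)
  \<comment> \<open>The open set \<open>V\<close> inside \<open>K\<close> serves twice:
    irreducibility applied to such sets makes the family filtered, and no member can lie in the
    complement of \<open>C\<close>.\<close>
  define \<K> where "\<K> = {K \<in> compact_saturated_sets X. \<exists>V. openin X V \<and> V \<subseteq> K \<and> C \<inter> V \<noteq> {}}"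
  have small: "\<exists>K\<in>\<K>. K \<subseteq> U" if U: "openin X U" "C \<inter> U \<noteq> {}" for U
  proof -
    obtain c where c: "c \<in> C" "c \<in> U"
      using U(2) by blast
    obtain V where V: "way_below (open_lattice X) V U" "c \<in> V"
      using core_compact_nbhd[OF assms(1) U(1) c(2)] .
    obtain K where "compactin X K" "saturatedin X K" "V \<subseteq> K" "K \<subseteq> U"
      using compact_saturated_between_way_below[OF assms V(1)] .
    then show ?thesis
      using c(1) V way_below_openD(1)[OF V(1)] unfolding compact_saturated_sets_def \<K>_def by blast
  qed
  have filtered: "filtered_family \<K>"
    unfolding filtered_family_def
  proof (intro conjI ballI)
    show "\<K> \<noteq> {}"
      using small[of "topspace X"] C_top by blast
    fix K L assume "K \<in> \<K>" "L \<in> \<K>"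
    then obtain V V' where V: "openin X V" "V \<subseteq> K" "C \<inter> V \<noteq> {}"
      and V': "openin X V'" "V' \<subseteq> L" "C \<inter> V' \<noteq> {}"
      unfolding \<K>_def by blast
    have "\<exists>K'\<in>\<K>. K' \<subseteq> V \<inter> V'"
      using V V' irreduciblein_meets_Int[OF C(2)] by (intro small) auto
    then show "\<exists>K'\<in>\<K>. K' \<subseteq> K \<inter> L"
      using V(2) V'(2) by blast
  qed
  have "\<not> \<Inter>\<K> \<subseteq> topspace X - C"
  proof
    assume le: "\<Inter>\<K> \<subseteq> topspace X - C"
    have "openin X (topspace X - C)"
      using C(1) by blast
    then obtain K where "K \<in> \<K>" "K \<subseteq> topspace X - C"
      using well_filtered_spaceE[OF assms(2) _ _ filtered le] by (auto simp: \<K>_def)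
    then show False
      unfolding \<K>_def by blast
  qed
  then obtain a where a: "\<And>K. K \<in> \<K> \<Longrightarrow> a \<in> K" "a \<notin> topspace X - C"
    by blast
  \<comment> \<open>Each open set that meets \<open>C\<close> contains a member of
    \<open>\<K>\<close>, hence \<open>a\<close>; this is what puts \<open>C\<close> inside the
    closure of \<open>a\<close>.\<close>
  have a_open: "a \<in> U" if "openin X U" "C \<inter> U \<noteq> {}" for U
    using small[OF that] a(1) by blast
  \<comment> \<open>\<open>a(2)\<close> alone does not place \<open>a\<close> in the space; the
    instance \<open>topspace X\<close> of \<open>a_open\<close> does.\<close>
  have "a \<in> C"
    using a_open[of "topspace X"] a(2) C_top by blast
  then have "X closure_of {a} \<subseteq> C"
    using C(1) by (simp add: closure_of_minimal)
  moreover have "C \<subseteq> X closure_of {a}"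
    using a_open C_top(1) unfolding in_closure_of subset_iff by blast
  ultimately have "C = X closure_of {a}"
    by simp
  moreover have "t0_space X"
    using assms(2) by (simp add: well_filtered_space_def)
  ultimately show "\<exists>!a. a \<in> topspace X \<and> C = X closure_of {a}"
    using \<open>a \<in> C\<close> C_top(1) by (metis subsetD t0_space_closure_of_singleton_inject)
qed

end
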